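(* $$\sum_{n=1}^{\infty}\binom{2n}{n}\binom{2n+2}{n+1}\frac{1}{16^n(n+1)(2n+3)}=\frac{22}{3}-\frac{8}{\pi}-\frac{16G}{\pi},$$ where $G$ denotes Catalan's constant.
   Context: Catalan's constant is $G:=\sum_{n=0}^{\infty}\frac{(-1)^n}{(2n+1)^2}\approx 0.915965$. $\binom{n}{m}$ denotes the usual binomial coefficient for non-negative integers $n,m$. *)

theory Defs
  imports "HOL-Analysis.Analysis"
begin

definition catalan_const :: real where
  "catalan_const = (\<Sum>n. (-1) ^ n / real (2 * n + 1) ^ 2)"

lemma summable_catalan_const: "summable (\<lambda>n. (-1) ^ n / real (2 * n + 1) ^ 2)"
proof (rule summable_comparison_test')
  show "summable (\<lambda>n. 1 / real (Suc n) ^ 2)"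
    using inverse_squares_sums by (simp add: sums_iff add.commute)
  show "norm ((-1) ^ n / real (2 * n + 1) ^ 2) \<le> 1 / real (Suc n) ^ 2" if "n \<ge> 0" for n
    unfolding norm_divide norm_power
    by (simp add: frac_le power_mono)
qed

end

theory Submission
  imports Defs "HOL-Real_Asymp.Real_Asymp"
begin

text \<open>
  Write \<open>a m\<close> for the central binomial coefficient divided by \<open>4 ^ m\<close>. Since
  \<open>a (m + 1) = a m * (2 m + 1) / (2 m + 2)\<close>, the summand for \<open>n = m - 1\<close> is
  \<open>8 * (a m)\<^sup>2 / (4 m\<^sup>2 - 1) = 4 * ((a m)\<^sup>2 / (2 m - 1) - (a m)\<^sup>2 / (2 m + 1))\<close>, so that the sum
  is determined by two series over all \<open>m \<ge> 0\<close>, less the two terms \<open>m = 0\<close> and \<open>m = 1\<close>, which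
  contribute \<open>- 8 + 2 / 3 = - 22 / 3\<close>.

  The series of \<open>(a m)\<^sup>2 / (2 m - 1)\<close> telescopes, and Wallis' product gives its value
  \<open>- 2 / \<pi>\<close> (\<open>sums_wallis_ratio_square_telescoping\<close>).

  The series of \<open>(a m)\<^sup>2 / (2 m + 1)\<close> is \<open>4 G / \<pi>\<close>. One factor \<open>a m\<close> is the mean of
  \<open>sin ^ (2 m)\<close> over \<open>[0, \<pi>/2]\<close> (\<open>wallis_integral\<close>); the other, together with \<open>1 / (2 m + 1)\<close>,
  is a Taylor coefficient of arcsin (\<open>arcsin_series\<close>). Integrating \<open>arcsin (sin t) / sin t\<close> termwise
  therefore turns the series into \<open>2 / \<pi>\<close> times the integral of \<open>t / sin t\<close> over \<open>[0, \<pi>/2]\<close>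
  (\<open>integral_t_over_sin_eq_wallis_ratio_series\<close>). Finally that integral is \<open>2 G\<close>
  (\<open>integral_t_over_sin\<close>), because \<open>2 Ti (tan (t / 2))\<close> is an antiderivative, where
  \<open>Ti x\<close> is the integral of \<open>arctan u / u\<close> from \<open>0\<close> to \<open>x\<close>, whose power series at \<open>x = 1\<close> is
  Catalan's constant.
\<close>

section \<open>Normalised central binomial coefficients\<close>

definition wallis_ratio :: "nat \<Rightarrow> real" where
  "wallis_ratio n = real ((2 * n) choose n) / 4 ^ n"

lemma wallis_ratio_0 [simp]: "wallis_ratio 0 = 1"
  by (simp add: wallis_ratio_def)

lemma wallis_ratio_Suc:
  "wallis_ratio (Suc n) = wallis_ratio n * ((2 * real n + 1) / (2 * real n + 2))"
proof -
  define q where "q = (2 * real n + 1) / (2 * real n + 2)"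
  have "real ((2 * Suc n) choose Suc n) = fact (2 * Suc n) / (fact (Suc n) * fact (Suc n))"
    by (subst binomial_fact) auto
  also have "\<dots> = (2 * real n + 2) * (2 * real n + 1) * fact (2 * n) / ((real n + 1)\<^sup>2 * (fact n * fact n))"
    by (simp add: algebra_simps power2_eq_square)
  also have "\<dots> = (2 * real n + 2) * (2 * real n + 1) / (real n + 1)\<^sup>2 * real ((2 * n) choose n)"
    by (subst binomial_fact) auto
  finally have "wallis_ratio (Suc n) = (2 * real n + 2) * (2 * real n + 1) / (real n + 1)\<^sup>2 * wallis_ratio n / 4"
    unfolding wallis_ratio_def by simp
  also have "(2 * real n + 2) * (2 * real n + 1) / (real n + 1)\<^sup>2 = 4 * q"
    unfolding q_def by (simp add: divide_simps power2_eq_square) (simp add: algebra_simps)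
  finally show ?thesis unfolding q_def [symmetric] by simp
qed

lemma wallis_ratio_nonneg: "0 \<le> wallis_ratio n"
  by (simp add: wallis_ratio_def)

text \<open>The left-hand side is in fact decreasing, with limit \<open>2 / \<pi>\<close>; the bound gives the decay of order
  \<open>n powr (-1/2)\<close> on which the summability below rests.\<close>

lemma wallis_ratio_square_le: "wallis_ratio n ^ 2 * (2 * real n + 1) \<le> 1"
proof (induction n)
  case (Suc n)
  have "(2 * real n + 1) * (2 * real n + 3) \<le> (2 * real n + 2)\<^sup>2"
    by (simp add: power2_eq_square algebra_simps)
  then have q: "(2 * real n + 1) * (2 * real n + 3) / (2 * real n + 2)\<^sup>2 \<le> 1"
    by (intro divide_le_eq_1_pos [THEN iffD2] zero_less_power) auto
  have "wallis_ratio (Suc n) ^ 2 * (2 * real (Suc n) + 1)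
      = (wallis_ratio n ^ 2 * (2 * real n + 1)) * ((2 * real n + 1) * (2 * real n + 3) / (2 * real n + 2)\<^sup>2)"
    by (simp add: wallis_ratio_Suc power_mult_distrib power_divide power2_eq_square algebra_simps)
  also have "\<dots> \<le> 1 * 1"
    using Suc q by (intro mult_mono) auto
  finally show ?case by simp
qed auto

lemma wallis_ratio_le_one: "wallis_ratio n \<le> 1"
proof -
  have "wallis_ratio n ^ 2 * 1 \<le> wallis_ratio n ^ 2 * (2 * real n + 1)"
    by (intro mult_left_mono) auto
  also note wallis_ratio_square_le
  finally show ?thesis by (simp add: power_le_one_iff wallis_ratio_nonneg abs_square_le_1)
qed

text \<open>This dominates the arcsin series up to the endpoint \<open>x = 1\<close>, which allows termwise integration
  over the whole of \<open>[0, \<pi>/2]\<close>.\<close>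

lemma summable_wallis_ratio: "summable (\<lambda>n. wallis_ratio n / (2 * real n + 1))"
proof (rule summable_comparison_test')
  show "summable (\<lambda>n. real n powr (-3/2))"
    by (subst summable_real_powr_iff) auto
next
  fix n :: nat assume n: "1 \<le> n"
  have "wallis_ratio n ^ 2 * real n \<le> wallis_ratio n ^ 2 * (2 * real n + 1)"
    by (intro mult_left_mono) auto
  also note wallis_ratio_square_le
  finally have "(wallis_ratio n * sqrt (real n))\<^sup>2 \<le> 1"
    by (simp add: power_mult_distrib)
  then have "wallis_ratio n * sqrt (real n) \<le> 1"
    by (simp add: abs_square_le_1 wallis_ratio_nonneg)
  then have "wallis_ratio n \<le> 1 / sqrt (real n)"
    using n by (simp add: field_simps)
  then have "wallis_ratio n / (2 * real n + 1) \<le> (1 / sqrt (real n)) / real n"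
    using n by (intro frac_le) auto
  also have "\<dots> = real n powr (-1/2) * real n powr (-1)"
    using n by (simp add: powr_minus powr_half_sqrt field_simps)
  also have "\<dots> = real n powr (-3/2)"
    by (subst powr_add [symmetric]) simp
  finally show "norm (wallis_ratio n / (2 * real n + 1)) \<le> real n powr (-3/2)"
    by (simp add: wallis_ratio_nonneg)
qed

text \<open>Up to the factor \<open>2 n + 1\<close>, the square of the ratio is the reciprocal of the partial Wallis
  product, so the limit of that product gives the asymptotics of the ratio.\<close>

lemma wallis_ratio_prod:
  "(\<Prod>k=1..n. (4 * real k ^ 2) / (4 * real k ^ 2 - 1)) * (wallis_ratio n ^ 2 * (2 * real n + 1)) = 1"
proof (induction n)
  case (Suc n)
  let ?P = "\<Prod>k=1..n. (4 * real k ^ 2) / (4 * real k ^ 2 - 1)"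
  have f: "(2 * real n + 2)\<^sup>2 - 1 = (2 * real n + 1) * (2 * real n + 3)"
    "4 * real (Suc n) ^ 2 = (2 * real n + 2)\<^sup>2"
    by (simp_all add: power2_eq_square algebra_simps)
  let ?a = "(2 * real n + 1) * (2 * real n + 3)" and ?b = "(2 * real n + 2)\<^sup>2"
  have P: "(\<Prod>k=1..Suc n. (4 * real k ^ 2) / (4 * real k ^ 2 - 1)) = ?P * (?b / ?a)"
    by (subst prod.nat_ivl_Suc', simp) (simp only: f, simp only: mult.commute)
  have W: "wallis_ratio (Suc n) ^ 2 * (2 * real (Suc n) + 1) = wallis_ratio n ^ 2 * (2 * real n + 1) * (?a / ?b)"
    by (simp add: wallis_ratio_Suc power_mult_distrib power_divide power2_eq_square algebra_simps)
  have "?a \<noteq> 0" "?b \<noteq> 0" by (simp_all add: add_nonneg_eq_0_iff)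
  then have "?b / ?a * (?a / ?b) = 1" by simp
  then have "(?P * (?b / ?a)) * (wallis_ratio n ^ 2 * (2 * real n + 1) * (?a / ?b))
      = ?P * (wallis_ratio n ^ 2 * (2 * real n + 1))"
    by (metis (no_types) mult.assoc mult.left_commute mult_1_right)
  then show ?case unfolding P W Suc .
qed auto

lemma wallis_ratio_square_limit: "(\<lambda>n. wallis_ratio n ^ 2 * (2 * real n + 1)) \<longlonglongrightarrow> 2 / pi"
proof -
  have "(\<lambda>n. inverse (\<Prod>k=1..n. (4 * real k ^ 2) / (4 * real k ^ 2 - 1))) \<longlonglongrightarrow> inverse (pi / 2)"
    by (intro tendsto_inverse wallis) auto
  moreover have "inverse (\<Prod>k=1..n. (4 * real k ^ 2) / (4 * real k ^ 2 - 1)) = wallis_ratio n ^ 2 * (2 * real n + 1)" for n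
    using wallis_ratio_prod[of n] by (rule inverse_unique)
  ultimately show ?thesis by simp
qed

text \<open>The rational factor \<open>4 n\<^sup>2 / (2 n - 1)\<close> in \<open>t\<close> is what Gosper's algorithm yields: by the
  recurrence \<open>t (n + 1) = (a n)\<^sup>2 * (2 n + 1)\<close>, so consecutive values of \<open>t\<close> differ by exactly one
  term of the series.\<close>

lemma sums_wallis_ratio_square_telescoping:
  "(\<lambda>n. wallis_ratio n ^ 2 / (2 * real n - 1)) sums (- 2 / pi)"
proof -
  define t where "t n = wallis_ratio n ^ 2 * (4 * real n ^ 2 / (2 * real n - 1))" for n
  have odd: "2 * real n - 1 \<noteq> 0" for n
  proof -
    have "real (2 * n) \<noteq> real 1" unfolding of_nat_eq_iff by presburger
    then show ?thesis by simp
  qed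
  have step: "t n - t (Suc n) = wallis_ratio n ^ 2 / (2 * real n - 1)" for n
  proof -
    have "t (Suc n) = wallis_ratio n ^ 2 * (2 * real n + 1)"
      unfolding t_def wallis_ratio_Suc
      by (simp add: power_mult_distrib power_divide divide_simps) (simp add: algebra_simps power2_eq_square)
    then have "t n - t (Suc n) = wallis_ratio n ^ 2 * (4 * real n ^ 2 / (2 * real n - 1) - (2 * real n + 1))"
      by (simp add: t_def right_diff_distrib)
    also have "4 * real n ^ 2 / (2 * real n - 1) - (2 * real n + 1) = 1 / (2 * real n - 1)"
      using odd[of n] by (simp add: field_simps power2_eq_square)
    finally show ?thesis by simp
  qed
  have lim: "(\<lambda>n. (wallis_ratio n ^ 2 * (2 * real n + 1)) * (4 * real n ^ 2 / ((2 * real n - 1) * (2 * real n + 1)))) 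
      \<longlonglongrightarrow> 2 / pi * 1"
    by (intro tendsto_mult wallis_ratio_square_limit) real_asymp
  have "t = (\<lambda>n. (wallis_ratio n ^ 2 * (2 * real n + 1)) * (4 * real n ^ 2 / ((2 * real n - 1) * (2 * real n + 1))))"
    by (simp add: t_def fun_eq_iff add_nonneg_eq_0_iff)
  with lim have "t \<longlonglongrightarrow> 2 / pi" by simp
  from telescope_sums'[OF this] show ?thesis
    unfolding step by (simp add: t_def)
qed

section \<open>Two facts on power series\<close>

lemma uniform_limit_absolutely_summable_powers:
  fixes d :: "nat \<Rightarrow> real"
  assumes "summable (\<lambda>n. \<bar>d n\<bar>)"
  shows "uniform_limit {-1..1} (\<lambda>N x. \<Sum>n<N. d n * x ^ e n) (\<lambda>x. \<Sum>n. d n * x ^ e n) sequentially"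
proof (rule Weierstrass_m_test)
  fix n and x :: real assume "x \<in> {-1..1}"
  then show "norm (d n * x ^ e n) \<le> \<bar>d n\<bar>"
    by (auto simp: abs_mult power_abs intro!: mult_left_le power_le_one)
qed fact

text \<open>The coefficients are written as \<open>d n / (2 n + 1)\<close> since differentiation then leaves the bounded
  sequence \<open>d\<close>, and a geometric series dominates the derivatives. It is used for arcsin and for the
  integral of \<open>arctan u / u\<close>.\<close>

lemma odd_series_derivative:
  fixes d :: "nat \<Rightarrow> real"
  assumes d: "\<And>n. \<bar>d n\<bar> \<le> 1" and x: "\<bar>x\<bar> < 1"
  shows "((\<lambda>x. \<Sum>n. d n / (2 * real n + 1) * x ^ (2 * n + 1)) has_real_derivative (\<Sum>n. d n * x ^ (2 * n))) (at x)"
proof -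
  obtain r where r: "\<bar>x\<bar> < r" "r < 1" using x dense by blast
  show ?thesis
  proof (rule has_field_derivative_series'(2)[where f = "\<lambda>n x. d n / (2 * real n + 1) * x ^ (2 * n + 1)"
      and f' = "\<lambda>n x. d n * x ^ (2 * n)" and S = "{-r<..<r}" and ?x0.0 = 0 and x = x])
    show "((\<lambda>x. d n / (2 * real n + 1) * x ^ (2 * n + 1)) has_real_derivative d n * y ^ (2 * n)) (at y within {-r<..<r})" for n y
      by (rule derivative_eq_intros refl | simp add: field_simps add_nonneg_eq_0_iff)+
    show "uniformly_convergent_on {-r<..<r} (\<lambda>N y. \<Sum>n<N. d n * y ^ (2 * n))"
    proof (rule Weierstrass_m_test')
      show "summable (\<lambda>n. (r ^ 2) ^ n)"
        using r by (intro summable_geometric) (auto simp: abs_square_less_1)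
      fix n y assume "y \<in> {-r<..<r}"
      then have "\<bar>y\<bar> ^ (2 * n) \<le> r ^ (2 * n)" by (intro power_mono) auto
      with d[of n] have "\<bar>d n\<bar> * \<bar>y\<bar> ^ (2 * n) \<le> 1 * r ^ (2 * n)" by (intro mult_mono) auto
      then show "norm (d n * y ^ (2 * n)) \<le> (r ^ 2) ^ n"
        by (simp add: abs_mult power_abs power_mult)
    qed
  qed (use r in \<open>auto simp: interior_open\<close>)
qed

section \<open>The arcsin series\<close>

lemma gbinomial_minus_half: "((-1/2) gchoose n) * (-1) ^ n = wallis_ratio n"
proof (induction n)
  case (Suc n)
  define q where "q = (2 * real n + 1) / (2 * real n + 2)"
  have "(-1/2 - real n) / (real n + 1) = - q"
    by (simp add: q_def divide_simps)
  moreover have "((-1/2 :: real) gchoose Suc n) = ((-1/2) gchoose n) * ((-1/2 - real n) / (real n + 1))"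
    using gbinomial_absorb_comp[of "-1/2 :: real" n] gbinomial_absorption[of n "-1/2 :: real"]
    by (simp add: field_simps)
  ultimately have "((-1/2 :: real) gchoose Suc n) = ((-1/2) gchoose n) * (- q)" by simp
  then have "((-1/2 :: real) gchoose Suc n) * (-1) ^ Suc n = ((-1/2) gchoose n) * (-1) ^ n * q"
    by simp
  then show ?case unfolding Suc wallis_ratio_Suc q_def .
qed auto

lemma wallis_ratio_sums_inverse_sqrt:
  assumes "\<bar>x\<bar> < 1"
  shows "(\<lambda>n. wallis_ratio n * x ^ (2 * n)) sums (1 / sqrt (1 - x\<^sup>2))"
proof -
  have "\<bar>- (x\<^sup>2)\<bar> < 1" using assms by (simp add: abs_square_less_1)
  from gen_binomial_real[OF this, of "-1/2"]
  have "(\<lambda>n. ((-1/2) gchoose n) * (-1) ^ n * x ^ (2 * n)) sums ((1 - x\<^sup>2) powr (-1/2))"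
    by (simp add: power_minus[of "x\<^sup>2"] power_mult mult.assoc)
  moreover have "(1 - x\<^sup>2) powr (-1/2) = 1 / sqrt (1 - x\<^sup>2)"
  proof -
    have "0 \<le> 1 - x\<^sup>2" using \<open>\<bar>- (x\<^sup>2)\<bar> < 1\<close> by simp
    then show ?thesis
      using powr_minus[of "1 - x\<^sup>2" "1/2"] by (simp only: powr_half_sqrt minus_divide_left inverse_eq_divide)
  qed
  ultimately show ?thesis by (simp only: gbinomial_minus_half)
qed

text \<open>Both sides vanish at \<open>0\<close> and have derivative \<open>1 / sqrt (1 - x\<^sup>2)\<close>, the left one by the binomial
  series with exponent \<open>-1/2\<close>.\<close>

lemma arcsin_series:
  assumes "\<bar>x\<bar> < 1"
  shows "(\<Sum>n. wallis_ratio n / (2 * real n + 1) * x ^ (2 * n + 1)) = arcsin x"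
proof -
  let ?f = "\<lambda>x. (\<Sum>n. wallis_ratio n / (2 * real n + 1) * x ^ (2 * n + 1))"
  have "((\<lambda>x. ?f x - arcsin x) has_real_derivative 0) (at y)" if "y \<in> {-1<..<1}" for y
  proof -
    have y: "\<bar>y\<bar> < 1" using that by auto
    have "(?f has_real_derivative (1 / sqrt (1 - y\<^sup>2))) (at y)"
      using odd_series_derivative[of wallis_ratio y] y sums_unique[OF wallis_ratio_sums_inverse_sqrt[OF y]]
      by (simp add: wallis_ratio_nonneg wallis_ratio_le_one)
    from DERIV_diff[OF this DERIV_arcsin[of y]] show ?thesis
      using y by (simp add: divide_inverse)
  qed
  then have "?f x - arcsin x = ?f 0 - arcsin 0"
    using assms by (intro DERIV_isconst3[of "-1" 1]) auto
  then show ?thesis by simp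
qed

section \<open>The integral of \<open>t / sin t\<close>\<close>

text \<open>The function \<open>sin t ^ (2 n + 1) * cos t\<close> vanishes at both ends, so its derivative, a combination
  of \<open>sin t ^ (2 n)\<close> and \<open>sin t ^ (2 n + 2)\<close>, integrates to zero. This is the recurrence of the
  ratios.\<close>

lemma wallis_integral:
  "((\<lambda>t. sin t ^ (2 * n)) has_integral (pi / 2 * wallis_ratio n)) {0..pi / 2}"
proof (induction n)
  case 0
  show ?case using has_integral_const_real[of "1::real" 0 "pi/2"]
    by (simp only: content_real_if) simp
next
  case (Suc n)
  have "((\<lambda>t. (2 * real n + 1) * sin t ^ (2 * n) - (2 * real n + 2) * sin t ^ (2 * Suc n)) 
     has_integral (sin (pi/2) ^ (2 * n + 1) * cos (pi/2) - sin 0 ^ (2 * n + 1) * cos 0)) {0..pi/2}"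
  proof (rule fundamental_theorem_of_calculus)
    fix t :: real
    have "((\<lambda>t. sin t ^ (2 * n + 1) * cos t) has_real_derivative
       ((2 * real n + 1) * sin t ^ (2 * n) * cos t * cos t - sin t ^ (2 * n + 1) * sin t)) (at t)"
      by (rule derivative_eq_intros refl | simp)+
    also have "(2 * real n + 1) * sin t ^ (2 * n) * cos t * cos t - sin t ^ (2 * n + 1) * sin t
      = (2 * real n + 1) * sin t ^ (2 * n) - (2 * real n + 2) * sin t ^ (2 * Suc n)"
    proof -
      have c: "cos t * cos t = 1 - sin t * sin t" using sin_cos_squared_add[of t] by (simp add: power2_eq_square)
      have "(2 * real n + 1) * sin t ^ (2 * n) * cos t * cos t = (2 * real n + 1) * sin t ^ (2 * n) * (cos t * cos t)"
        by (simp only: mult.assoc)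
      then show ?thesis unfolding c by (simp add: algebra_simps)
    qed
    finally show "((\<lambda>t. sin t ^ (2 * n + 1) * cos t) has_vector_derivative
       ((2 * real n + 1) * sin t ^ (2 * n) - (2 * real n + 2) * sin t ^ (2 * Suc n))) (at t within {0..pi/2})"
      by (simp add: has_real_derivative_iff_has_vector_derivative has_vector_derivative_at_within)
  qed auto
  from has_integral_diff[OF has_integral_mult_right[OF Suc, of "2 * real n + 1"] this]
  have "((\<lambda>t. (2 * real n + 2) * sin t ^ (2 * Suc n)) has_integral 
     ((2 * real n + 1) * (pi / 2 * wallis_ratio n))) {0..pi/2}"
    by simp
  \<comment> \<open>It remains to divide by \<open>2 n + 2\<close>.\<close>
  from has_integral_mult_right[OF this, of "inverse (2 * real n + 2)"]
  have *: "((\<lambda>t. inverse (2 * real n + 2) * ((2 * real n + 2) * sin t ^ (2 * Suc n))) has_integral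
     (inverse (2 * real n + 2) * ((2 * real n + 1) * (pi / 2 * wallis_ratio n)))) {0..pi/2}" .
  have "2 * real n + 2 \<noteq> 0" by (simp add: add_nonneg_eq_0_iff)
  moreover have "inverse c * (c * z) = z" if "c \<noteq> 0" for c z :: real
    using that by simp
  ultimately have 1: "inverse (2 * real n + 2) * ((2 * real n + 2) * z) = z" for z
    by blast
  have 2: "inverse (2 * real n + 2) * ((2 * real n + 1) * (pi / 2 * wallis_ratio n)) = pi / 2 * wallis_ratio (Suc n)"
    unfolding wallis_ratio_Suc by (simp only: divide_inverse mult_ac)
  show ?case using * unfolding 1 2 .
qed

text \<open>Substituting \<open>x = sin t\<close> in the arcsin series and dividing by \<open>sin t\<close> expands \<open>t / sin t\<close> in
  even powers of \<open>sin t\<close>. The convergence is uniform, so it may be integrated term by term, and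
  each term is a Wallis integral. The sum \<open>S\<close> is left anonymous because its value comes from a
  second evaluation of the same integral.\<close>

lemma integral_t_over_sin_eq_wallis_ratio_series:
  "\<exists>S. (\<lambda>n. wallis_ratio n ^ 2 / (2 * real n + 1)) sums S \<and>
     ((\<lambda>t. t / sin t) has_integral (pi / 2 * S)) {0..pi / 2}"
proof -
  define c where "c n = wallis_ratio n / (2 * real n + 1)" for n
  define g where "g x = (\<Sum>n. c n * x ^ (2 * n))" for x
  have c: "summable (\<lambda>n. \<bar>c n\<bar>)"
    using summable_wallis_ratio by (simp add: c_def wallis_ratio_nonneg)
  have "uniform_limit {0..pi/2} (\<lambda>N t. \<Sum>n<N. c n * sin t ^ (2 * n)) (\<lambda>t. g (sin t)) sequentially"
    unfolding g_def by (rule uniform_limit_compose'[OF uniform_limit_absolutely_summable_powers[OF c]]) auto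
  then obtain I J where I: "\<And>N. ((\<lambda>t. \<Sum>n<N. c n * sin t ^ (2 * n)) has_integral I N) {0..pi/2}"
      and J: "((\<lambda>t. g (sin t)) has_integral J) {0..pi/2}" and lim: "I \<longlonglongrightarrow> J"
    by (rule uniform_limit_integral) (auto intro!: continuous_intros)
  have "I = (\<lambda>N. \<Sum>n<N. c n * (pi / 2 * wallis_ratio n))"
    by (rule ext, rule has_integral_unique[OF I]) (intro has_integral_sum has_integral_mult_right wallis_integral; simp)
  with lim have J': "(\<lambda>n. c n * (pi / 2 * wallis_ratio n)) sums J"
    by (simp only: sums_def)
  have cancel: "2 / pi * (w / a * (pi / 2 * w)) = w ^ 2 / a" for w a :: real
    by (simp add: power2_eq_square)
  from sums_mult[OF J', of "2 / pi"]
  have S: "(\<lambda>n. wallis_ratio n ^ 2 / (2 * real n + 1)) sums (2 / pi * J)"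
    by (simp only: c_def cancel)
  have "((\<lambda>t. t / sin t) has_integral J) {0..pi/2}"
  proof (rule has_integral_spike_finite[OF _ _ J])
    \<comment> \<open>At \<open>t = 0\<close> the quotient has the value \<open>0 / 0 = 0\<close>, unlike the series, and at \<open>t = \<pi>/2\<close> the
       argument \<open>sin t = 1\<close> lies outside the open interval of the arcsin series.\<close>
    fix t assume t: "t \<in> {0..pi/2} - {0, pi/2}"
    then have s: "0 < sin t" by (intro sin_gt_zero) auto
    have "\<bar>sin t\<bar> < 1" using s t sin_monotone_2pi[of t "pi/2"] by auto
    have "summable (\<lambda>n. c n * sin t ^ (2 * n))"
    proof (rule summable_comparison_test'[OF c])
      show "norm (c n * sin t ^ (2 * n)) \<le> \<bar>c n\<bar>" for n
        by (auto simp: abs_mult power_abs intro!: mult_left_le power_le_one)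
    qed
    then have "sin t * g (sin t) = (\<Sum>n. c n * sin t ^ (2 * n + 1))"
      unfolding g_def by (subst suminf_mult [symmetric]) (simp_all add: mult_ac)
    also have "\<dots> = arcsin (sin t)"
      unfolding c_def by (rule arcsin_series) fact
    also have "\<dots> = t" using t by (intro arcsin_sin) auto
    finally show "t / sin t = g (sin t)" using s by (simp add: field_simps)
  qed auto
  with S show ?thesis by (intro exI[of _ "2 / pi * J"]) simp
qed

text \<open>The inverse tangent integral, i.e. the integral of \<open>arctan u / u\<close> from \<open>0\<close> to \<open>x\<close>. Defining it by
  its power series on \<open>[-1, 1]\<close> makes its value at \<open>1\<close> literally the series of Catalan's constant;
  \<open>arctan_integral_derivative\<close> justifies the name.\<close>

definition arctan_integral :: "real \<Rightarrow> real" where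
  "arctan_integral x = (\<Sum>n. (-1) ^ n / real (2 * n + 1) ^ 2 * x ^ (2 * n + 1))"

lemma arctan_integral_1: "arctan_integral 1 = catalan_const"
  by (simp add: arctan_integral_def catalan_const_def)

lemma arctan_integral_0: "arctan_integral 0 = 0"
  by (simp add: arctan_integral_def)

lemma continuous_on_arctan_integral: "continuous_on {-1..1} arctan_integral"
proof -
  have "summable (\<lambda>n. \<bar>(-1) ^ n / real (2 * n + 1) ^ 2\<bar>)"
  proof (rule summable_comparison_test')
    show "summable (\<lambda>n. 1 / real (Suc n) ^ 2)"
      using inverse_squares_sums by (simp add: sums_iff add.commute)
    show "norm \<bar>(-1) ^ n / real (2 * n + 1) ^ 2\<bar> \<le> 1 / real (Suc n) ^ 2" for n
      by (simp add: frac_le power_mono power_abs abs_divide)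
  qed
  from uniform_limit_absolutely_summable_powers[OF this]
  have "uniform_limit {-1..1} (\<lambda>N x. \<Sum>n<N. (-1) ^ n / real (2 * n + 1) ^ 2 * x ^ (2 * n + 1)) arctan_integral sequentially"
    unfolding arctan_integral_def[abs_def] .
  then show ?thesis
    by (rule uniform_limit_theorem[rotated]) (auto intro!: continuous_intros always_eventually)
qed

lemma arctan_integral_derivative:
  assumes "\<bar>x\<bar> < 1" "x \<noteq> 0"
  shows "(arctan_integral has_real_derivative (arctan x / x)) (at x)"
proof -
  let ?d = "\<lambda>n. (-1) ^ n / (2 * real n + 1)"
  have arctan_integral: "arctan_integral = (\<lambda>x. \<Sum>n. ?d n / (2 * real n + 1) * x ^ (2 * n + 1))"
    by (simp add: arctan_integral_def[abs_def] power2_eq_square add.commute)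
  have "(\<Sum>n. ?d n * x ^ (2 * n)) = (\<Sum>n. (-1) ^ n * (1 / real (n * 2 + 1) * x ^ (n * 2 + 1)) / x)"
    using assms by (simp add: mult.commute[of _ 2] add.commute)
  also have "\<dots> = arctan x / x"
    using assms by (subst suminf_divide)
      (use arctan_series[of x] summable_arctan_series[of x] in auto)
  finally show ?thesis
    using odd_series_derivative[of ?d x] assms unfolding arctan_integral by (simp add: abs_divide power_abs)
qed

text \<open>With \<open>x = tan (t / 2)\<close> one has \<open>arctan x / x = (t / 2) / tan (t / 2)\<close> and
  \<open>dx/dt = 1 / (2 cos\<^sup>2 (t / 2))\<close>, whose product is \<open>t / (2 sin t)\<close>. The derivative is available only
  for \<open>x < 1\<close>, i.e. \<open>t < \<pi>/2\<close>; continuity of the antiderivative up to \<open>x = 1\<close> suffices at the end.\<close>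

lemma integral_t_over_sin: "((\<lambda>t. t / sin t) has_integral (2 * catalan_const)) {0..pi / 2}"
proof -
  have less_pi: "t < pi" if "t \<in> {0..pi/2}" for t
    using that pi_gt_zero unfolding atLeastAtMost_iff by linarith
  have tan_bound: "0 \<le> tan (t / 2) \<and> tan (t / 2) \<le> 1" if "t \<in> {0..pi/2}" for t
  proof -
    have "tan 0 \<le> tan (t/2)" by (rule tan_mono_le) (use that less_pi[OF that] in auto)
    moreover have "tan (t/2) \<le> tan (pi/4)" by (rule tan_mono_le) (use that less_pi[OF that] in auto)
    ultimately show ?thesis by (simp add: tan_45)
  qed
  have "((\<lambda>t. t / sin t) has_integral (2 * arctan_integral (tan (pi/2/2)) - 2 * arctan_integral (tan (0/2)))) {0..pi/2}"
  proof (rule fundamental_theorem_of_calculus_interior)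
    have "cos (t / 2) \<noteq> 0" if "t \<in> {0..pi/2}" for t
      using that less_pi[OF that] cos_gt_zero_pi[of "t/2"] by auto
    then have "continuous_on {0..pi/2} (\<lambda>t. tan (t / 2))" by (auto intro!: continuous_intros)
    then have "continuous_on {0..pi/2} (\<lambda>t. arctan_integral (tan (t / 2)))"
      by (rule continuous_on_compose2[OF continuous_on_arctan_integral]) (use tan_bound in force)
    then show "continuous_on {0..pi/2} (\<lambda>t. 2 * arctan_integral (tan (t / 2)))" by (intro continuous_intros)
  next
    fix t assume t: "t \<in> {0<..<pi/2}"
    have tan: "0 < tan (t/2)" "tan (t/2) < 1"
      using t tan_gt_zero[of "t/2"] tan_monotone[of "t/2" "pi/4"] by (auto simp: tan_45)
    have cos: "cos (t/2) > 0" and sin: "sin (t/2) > 0" using t by (auto intro!: cos_gt_zero_pi sin_gt_zero)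
    have "((\<lambda>t. 2 * arctan_integral (tan (t / 2))) has_real_derivative
       (2 * ((arctan (tan (t/2)) / tan (t/2)) * (inverse ((cos (t/2))\<^sup>2) * (1 / 2))))) (at t)"
      by (intro DERIV_cmult DERIV_chain2[OF arctan_integral_derivative] DERIV_chain2[OF DERIV_tan])
         (use tan cos in \<open>auto intro!: derivative_eq_intros\<close>)
    also have "arctan (tan (t/2)) = t/2" using t by (intro arctan_tan) auto
    also have "2 * ((t/2 / tan (t/2)) * (inverse ((cos (t/2))\<^sup>2) * (1 / 2))) = t / sin t"
      using sin_double[of "t/2"] cos sin by (simp add: tan_def field_simps power2_eq_square)
    finally show "((\<lambda>t. 2 * arctan_integral (tan (t / 2))) has_vector_derivative t / sin t) (at t)"
      by (simp add: has_real_derivative_iff_has_vector_derivative)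
  qed auto
  then show ?thesis by (simp add: arctan_integral_0 arctan_integral_1 tan_45)
qed

section \<open>Evaluation of the series\<close>

lemma sums_wallis_ratio_square_catalan:
  "(\<lambda>n. wallis_ratio n ^ 2 / (2 * real n + 1)) sums (4 * catalan_const / pi)"
proof -
  obtain S where S: "(\<lambda>n. wallis_ratio n ^ 2 / (2 * real n + 1)) sums S"
    and "((\<lambda>t. t / sin t) has_integral (pi / 2 * S)) {0..pi / 2}"
    using integral_t_over_sin_eq_wallis_ratio_series by blast
  then have "pi / 2 * S = 2 * catalan_const"
    using integral_t_over_sin has_integral_unique by blast
  then have "S = 4 * catalan_const / pi" by (simp add: field_simps)
  with S show ?thesis by simp
qed

theorem theorem1:
  shows "(\<lambda>k. let n = Suc k in
           real ((2 * n) choose n) * real ((2 * n + 2) choose (n + 1))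
             * (1 / (16 ^ n * real (n + 1) * real (2 * n + 3))))
         sums (22 / 3 - 8 / pi - 16 * catalan_const / pi)"
proof -
  define u where "u m = 4 * (wallis_ratio m ^ 2 / (2 * real m - 1) - wallis_ratio m ^ 2 / (2 * real m + 1))" for m
  have "u sums (4 * (- 2 / pi - 4 * catalan_const / pi))"
    unfolding u_def
    by (intro sums_mult sums_diff sums_wallis_ratio_square_telescoping sums_wallis_ratio_square_catalan)
  \<comment> \<open>The summand with \<open>n = Suc k\<close> is \<open>u (n + 1)\<close>, so the series starts at \<open>u 2\<close>.\<close>
  then have "(\<lambda>k. u (k + 2)) sums (4 * (- 2 / pi - 4 * catalan_const / pi) - (\<Sum>m<2. u m))"
    by (subst sums_iff_shift) simp
  also have "(\<Sum>m<2. u m) = - 22 / 3"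
    by (simp add: u_def numeral_2_eq_2 wallis_ratio_Suc power2_eq_square)
  also have "4 * (- 2 / pi - 4 * catalan_const / pi) - - 22 / 3 = 22 / 3 - 8 / pi - 16 * catalan_const / pi"
    by (simp add: field_simps)
  finally have *: "(\<lambda>k. u (k + 2)) sums (22 / 3 - 8 / pi - 16 * catalan_const / pi)" .
  have "u (Suc n) = real ((2 * n) choose n) * real ((2 * n + 2) choose (n + 1))
             * (1 / (16 ^ n * real (n + 1) * real (2 * n + 3)))" for n
  proof -
    have "real ((2 * n) choose n) = wallis_ratio n * 4 ^ n"
      by (simp add: wallis_ratio_def)
    moreover have "real ((2 * n + 2) choose (n + 1)) = wallis_ratio (Suc n) * 4 ^ Suc n"
      by (simp add: wallis_ratio_def)
    moreover have "(16 :: real) ^ n = 4 ^ n * 4 ^ n" by (simp flip: power_mult_distrib)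
    moreover have "(w * p) * (w' * (4 * p)) * (1 / (p * p * a * b)) = 4 * w * w' / (a * b)"
      if "p \<noteq> 0" for w w' p a b :: real
      using that by simp
    ultimately have "real ((2 * n) choose n) * real ((2 * n + 2) choose (n + 1))
             * (1 / (16 ^ n * real (n + 1) * real (2 * n + 3)))
       = 4 * wallis_ratio n * wallis_ratio (Suc n) / (real (n + 1) * real (2 * n + 3))"
      by (simp only: power_Suc power_eq_0_iff) simp
    also have "\<dots> = u (Suc n)"
      unfolding u_def wallis_ratio_Suc
      by (simp add: divide_simps add_nonneg_eq_0_iff) (simp add: algebra_simps power2_eq_square)
    finally show ?thesis ..
  qed
  with * show ?thesis by (simp add: Let_def)
qed

end
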